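(* For each $r\ge 1$ and each $R\subseteq[2]^r$, there is an $r$-ary $2$-gadget that $1$-realizes $R$.
   Context: An $r$-ary $q$-gadget is a triple $\mathcal{J}=(J,L,\mathbf{x})$ where $J$ is a graph, $L:V(J)\to 2^{[q]}$ is a list function, and $\mathbf{x}=(x_1,\dots,x_r)$ are distinguished vertices of $J$ (portals). For $\mathbf{d}\in[q]^r$, $\mathrm{cost}_{ed}(\mathcal{J},\mathbf{d})$ is the minimum size of a set $X$ of edges of $J$ such that there is a proper list coloring $\phi$ of $(J\setminus X,L)$ (a map $\phi:V(J)\to[q]$ with $\phi(v)\in L(v)$ and endpoints of every remaining edge colored differently) with $(\phi(x_1),\dots,\phi(x_r))=\mathbf{d}$. The gadget $\mathcal{J}$ realizes $R\subseteq[q]^r$ if there is an integer $k$ such that $\mathrm{cost}_{ed}(\mathcal{J},\mathbf{d})=k$ for all $\mathbf{d}\in R$ and $\mathrm{cost}_{ed}(\mathcal{J},\mathbf{d})>k$ for all $\mathbf{d}\notin R$; it $\omega$-realizes $R$ if additionally $\mathrm{cost}_{ed}(\mathcal{J},\mathbf{d})=k+\omega$ for all $\mathbf{d}\notin R$. *)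

theory Defs
  imports "HOL-Library.FuncSet" "HOL-Library.Extended_Real"
begin

record 'a ugraph =
  verts :: "'a set"
  edges :: "'a set set"

definition simple_graph :: "'a ugraph \<Rightarrow> bool" where
  "simple_graph G \<longleftrightarrow> finite (verts G) \<and> (\<forall>e\<in>edges G. e \<subseteq> verts G \<and> card e = 2)"

definition delete_edges :: "'a ugraph \<Rightarrow> 'a set set \<Rightarrow> 'a ugraph" where
  "delete_edges G X = G\<lparr>edges := edges G - X\<rparr>"

definition proper_list_coloring ::
  "nat \<Rightarrow> 'a ugraph \<Rightarrow> ('a \<Rightarrow> nat set) \<Rightarrow> ('a \<Rightarrow> nat) \<Rightarrow> bool" where
  "proper_list_coloring q G L \<phi> \<longleftrightarrow>
     \<phi> \<in> verts G \<rightarrow> {1..q} \<and>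
     (\<forall>v\<in>verts G. \<phi> v \<in> L v) \<and>
     (\<forall>u v. {u, v} \<in> edges G \<longrightarrow> \<phi> u \<noteq> \<phi> v)"

record 'a gadget =
  graph :: "'a ugraph"
  color_list :: "'a \<Rightarrow> nat set"
  portals :: "'a list"

definition is_gadget :: "nat \<Rightarrow> nat \<Rightarrow> 'a gadget \<Rightarrow> bool" where
  "is_gadget q r J \<longleftrightarrow>
     simple_graph (graph J) \<and>
     (\<forall>v\<in>verts (graph J). color_list J v \<subseteq> {1..q}) \<and>
     length (portals J) = r \<and> distinct (portals J) \<and> set (portals J) \<subseteq> verts (graph J)"

definition color_tuples :: "nat \<Rightarrow> nat \<Rightarrow> nat list set" where
  "color_tuples q r = {d. length d = r \<and> set d \<subseteq> {1..q}}"

text \<open>For a gadget the infimum ranges over finitely many edge sets, so it is a minimum unless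
  no edge set is admissible (some portal color violates its list, or some list is empty);
  in that case the cost is \<open>\<infinity>\<close>.\<close>

definition cost_ed :: "nat \<Rightarrow> 'a gadget \<Rightarrow> nat list \<Rightarrow> ereal" where
  "cost_ed q J d =
     (INF X \<in> {X. X \<subseteq> edges (graph J) \<and>
                  (\<exists>\<phi>. proper_list_coloring q (delete_edges (graph J) X) (color_list J) \<phi> \<and>
                       map \<phi> (portals J) = d)}.
        ereal (real (card X)))"

definition realizes_with :: "nat \<Rightarrow> nat \<Rightarrow> int \<Rightarrow> 'a gadget \<Rightarrow> nat list set \<Rightarrow> bool" where
  "realizes_with q r k J R \<longleftrightarrow>
     (\<forall>d\<in>R. cost_ed q J d = ereal (of_int k)) \<and>
     (\<forall>d\<in>color_tuples q r - R. cost_ed q J d > ereal (of_int k))"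

definition realizes :: "nat \<Rightarrow> nat \<Rightarrow> 'a gadget \<Rightarrow> nat list set \<Rightarrow> bool" where
  "realizes q r J R \<longleftrightarrow> (\<exists>k. realizes_with q r k J R)"

definition omega_realizes :: "nat \<Rightarrow> nat \<Rightarrow> int \<Rightarrow> 'a gadget \<Rightarrow> nat list set \<Rightarrow> bool" where
  "omega_realizes q r \<omega> J R \<longleftrightarrow>
     (\<exists>k. realizes_with q r k J R \<and>
          (\<forall>d\<in>color_tuples q r - R. cost_ed q J d = ereal (of_int (k + \<omega>))))"

end

theory Submission
  imports Defs "HOL-Library.Countable"
begin

text \<open>
  A gadget charges one for every monochromatic edge. Two observations reduce the theorem to small
  pieces. First, it suffices to charge, for each \<open>d \<in> R\<close>, some constant \<open>r\<close> if the portals are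
  colored by \<open>d\<close> and \<open>r + 1\<close> otherwise: summing over \<open>R\<close>, a tuple in \<open>R\<close> pays exactly one less than
  a tuple outside \<open>R\<close>. Second, a triangle \<open>w z x\<close> with a pendant edge from \<open>w\<close> to a vertex of the
  fixed color \<open>c\<close> costs, minimized over \<open>w\<close>, two if \<open>z\<close> and \<open>x\<close> both have the color other than \<open>c\<close>,
  and one in all remaining cases.

  For \<open>d \<in> R\<close> take adjacent selectors \<open>z\<^sub>1\<close>, \<open>z\<^sub>2\<close>. They are switched on when \<open>z\<^sub>c\<close> has color \<open>c\<close>,
  and a pendant edge from \<open>z\<^sub>1\<close> to a vertex of color 2 makes switching them off cost one. For every
  position \<open>i\<close> with \<open>d\<^sub>i = c\<close>, a triangle on \<open>z\<^bsub>3 - c\<^esub>\<close> and the portal \<open>x\<^sub>i\<close> penalizes a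
  switched-on selector whenever \<open>x\<^sub>i\<close> is not colored \<open>c\<close>. So the extra cost is one unless
  the portals are colored by \<open>d\<close>.
\<close>

section \<open>Deletion cost as a count of monochromatic edges\<close>

definition mono_edge :: "('a \<Rightarrow> nat) \<Rightarrow> 'a set \<Rightarrow> bool" where
  "mono_edge \<phi> e \<longleftrightarrow> (\<exists>c. \<forall>v\<in>e. \<phi> v = c)"

lemma mono_edge_doubleton [simp]: "mono_edge \<phi> {u, v} \<longleftrightarrow> \<phi> u = \<phi> v"
  by (auto simp: mono_edge_def)

lemma mono_edge_image: "mono_edge \<phi> (f ` e) \<longleftrightarrow> mono_edge (\<phi> \<circ> f) e"
  by (auto simp: mono_edge_def)

text \<open>A sum of indicators rather than a cardinality: it splits over disjoint unions and
  evaluates termwise on explicit edge sets.\<close>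

definition mono_count :: "('a \<Rightarrow> nat) \<Rightarrow> 'a set set \<Rightarrow> nat" where
  "mono_count \<phi> E = (\<Sum>e\<in>E. of_bool (mono_edge \<phi> e))"

lemma mono_count_eq_card: "finite E \<Longrightarrow> mono_count \<phi> E = card {e\<in>E. mono_edge \<phi> e}"
  by (simp add: mono_count_def sum_of_bool_eq Int_def)

lemma mono_count_image:
  assumes "inj f"
  shows "mono_count \<phi> ((`) f ` E) = mono_count (\<phi> \<circ> f) E"
proof -
  have "inj_on ((`) f) E"
    using assms by (simp add: inj_on_def inj_image_eq_iff)
  then show ?thesis
    by (simp add: mono_count_def sum.reindex mono_edge_image)
qed

text \<open>What remains of an admissible list coloring once the condition on edges is
  dropped.\<close>

definition portal_coloring :: "nat \<Rightarrow> 'a gadget \<Rightarrow> nat list \<Rightarrow> ('a \<Rightarrow> nat) \<Rightarrow> bool" where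
  "portal_coloring q J d \<phi> \<longleftrightarrow> \<phi> \<in> verts (graph J) \<rightarrow> {1..q} \<and>
     (\<forall>v\<in>verts (graph J). \<phi> v \<in> color_list J v) \<and> map \<phi> (portals J) = d"

lemma finite_edges:
  assumes "simple_graph G"
  shows "finite (edges G)"
proof (rule finite_subset)
  show "edges G \<subseteq> Pow (verts G)" and "finite (Pow (verts G))"
    using assms by (auto simp: simple_graph_def)
qed

text \<open>For a fixed coloring, the edge sets whose deletion makes it proper are exactly those
  containing all its monochromatic edges. Minimizing over deleted sets is therefore minimizing the
  number of monochromatic edges over colorings.\<close>

lemma cost_ed_eqI:
  assumes simple: "simple_graph (graph J)"
    and attained: "portal_coloring q J d \<phi>" "mono_count \<phi> (edges (graph J)) \<le> k"
    and minimal: "\<And>\<psi>. portal_coloring q J d \<psi> \<Longrightarrow> k \<le> mono_count \<psi> (edges (graph J))"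
  shows "cost_ed q J d = ereal (real k)"
proof -
  let ?E = "edges (graph J)"
  let ?adm = "\<lambda>X \<psi>. proper_list_coloring q (delete_edges (graph J) X) (color_list J) \<psi> \<and>
    map \<psi> (portals J) = d"
  have fin: "finite ?E"
    by (rule finite_edges) (rule simple)
  have adm_iff: "?adm X \<psi> \<longleftrightarrow> portal_coloring q J d \<psi> \<and> {e\<in>?E. mono_edge \<psi> e} \<subseteq> X" for X \<psi>
  proof -
    have doubleton: "\<exists>u v. e = {u, v}" if "e \<in> ?E" for e
      using simple that by (metis simple_graph_def card_2_iff)
    have "(\<forall>u v. {u, v} \<in> ?E - X \<longrightarrow> \<psi> u \<noteq> \<psi> v) \<longleftrightarrow> {e\<in>?E. mono_edge \<psi> e} \<subseteq> X"
    proof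
      assume *: "\<forall>u v. {u, v} \<in> ?E - X \<longrightarrow> \<psi> u \<noteq> \<psi> v"
      show "{e\<in>?E. mono_edge \<psi> e} \<subseteq> X"
      proof
        fix e assume e: "e \<in> {e\<in>?E. mono_edge \<psi> e}"
        then obtain u v where "e = {u, v}"
          using doubleton by blast
        then show "e \<in> X"
          using * e by auto
      qed
    next
      assume *: "{e\<in>?E. mono_edge \<psi> e} \<subseteq> X"
      show "\<forall>u v. {u, v} \<in> ?E - X \<longrightarrow> \<psi> u \<noteq> \<psi> v"
      proof (intro allI impI notI)
        fix u v assume "{u, v} \<in> ?E - X" and "\<psi> u = \<psi> v"
        then have "{u, v} \<in> {e\<in>?E. mono_edge \<psi> e}"
          by simp
        then show False
          using * \<open>{u, v} \<in> ?E - X\<close> by blast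
      qed
    qed
    then show ?thesis
      by (auto simp: proper_list_coloring_def portal_coloring_def delete_edges_def)
  qed
  show ?thesis
    unfolding cost_ed_def
  proof (rule antisym)
    let ?X = "{e\<in>?E. mono_edge \<phi> e}"
    have "?adm ?X \<phi>"
      using attained by (simp add: adm_iff)
    moreover have "ereal (real (card ?X)) \<le> ereal (real k)"
      using attained fin by (simp add: mono_count_eq_card)
    ultimately show "(INF X\<in>{X. X \<subseteq> ?E \<and> (\<exists>\<psi>. ?adm X \<psi>)}. ereal (real (card X))) \<le> ereal (real k)"
      by (intro INF_lower2[of ?X]) blast+
  next
    show "ereal (real k) \<le> (INF X\<in>{X. X \<subseteq> ?E \<and> (\<exists>\<psi>. ?adm X \<psi>)}. ereal (real (card X)))"
    proof (rule INF_greatest)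
      fix X assume "X \<in> {X. X \<subseteq> ?E \<and> (\<exists>\<psi>. ?adm X \<psi>)}"
      then obtain \<psi> where X: "X \<subseteq> ?E" and \<psi>: "?adm X \<psi>"
        by blast
      have "k \<le> mono_count \<psi> ?E"
        using \<psi> by (intro minimal) (simp add: adm_iff)
      also have "\<dots> = card {e\<in>?E. mono_edge \<psi> e}"
        using fin by (rule mono_count_eq_card)
      also have "\<dots> \<le> card X"
      proof (rule card_mono)
        show "finite X"
          using fin X by (rule rev_finite_subset)
        show "{e\<in>?E. mono_edge \<psi> e} \<subseteq> X"
          using \<psi> by (simp only: adm_iff)
      qed
      finally show "ereal (real k) \<le> ereal (real (card X))"
        by simp
    qed
  qed
qed

section \<open>Vertices and edges of the gadget\<close>

text \<open>Selectors and hubs carry the tuple they serve, so different tuples share only portals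
  and terminals. The singleton lists of the terminals supply the fixed colors.\<close>

datatype vertex = Portal nat | Terminal nat | Selector "nat list" nat | Hub "nat list" nat

instance vertex :: countable
  by countable_datatype

fun vertex_list :: "vertex \<Rightarrow> nat set" where
  "vertex_list (Terminal c) = {c}"
| "vertex_list _ = {1, 2}"

definition vertex_set :: "nat \<Rightarrow> nat list set \<Rightarrow> vertex set" where
  "vertex_set r R = Portal ` {..<r} \<union> Terminal ` {1, 2} \<union>
     (\<lambda>(d, c). Selector d c) ` (R \<times> {1, 2}) \<union> (\<lambda>(d, i). Hub d i) ` (R \<times> {..<r})"

definition selector_edges :: "nat list \<Rightarrow> vertex set set" where
  "selector_edges d = {{Selector d 1, Selector d 2}, {Selector d 1, Terminal 2}}"

text \<open>The triangle with its pendant edge. On the colors 1 and 2, \<open>3 - c\<close> is the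
  color other than \<open>c\<close>.\<close>

definition paw_edges :: "nat list \<Rightarrow> nat \<Rightarrow> vertex set set" where
  "paw_edges d i =
     {{Hub d i, Selector d (3 - d ! i)}, {Hub d i, Portal i},
      {Selector d (3 - d ! i), Portal i}, {Hub d i, Terminal (d ! i)}}"

definition tuple_edges :: "nat \<Rightarrow> nat list \<Rightarrow> vertex set set" where
  "tuple_edges r d = selector_edges d \<union> (\<Union>i<r. paw_edges d i)"

definition relation_edges :: "nat \<Rightarrow> nat list set \<Rightarrow> vertex set set" where
  "relation_edges r R = (\<Union>d\<in>R. tuple_edges r d)"

lemma color_tuples_2_nth:
  assumes "d \<in> color_tuples 2 r" and "i < r"
  shows "d ! i \<in> {1, 2}"
proof -
  have "d ! i \<in> set d" and "set d \<subseteq> {1..2}"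
    using assms by (simp_all add: color_tuples_def)
  then have "d ! i \<in> {1..2}"
    by (rule rev_subsetD)
  then show ?thesis
    by auto
qed

lemma finite_color_tuples: "finite (color_tuples q r)"
  using finite_lists_length_eq[of "{1..q}" r] by (simp add: color_tuples_def conj_commute)

lemma finite_tuple_edges: "finite (tuple_edges r d)"
  by (simp add: tuple_edges_def selector_edges_def paw_edges_def)

section \<open>Additivity of the count\<close>

lemma mono_count_selector_edges:
  "mono_count \<phi> (selector_edges d) =
     of_bool (\<phi> (Selector d 1) = \<phi> (Selector d 2)) + of_bool (\<phi> (Selector d 1) = \<phi> (Terminal 2))"
  by (simp add: mono_count_def selector_edges_def doubleton_eq_iff)

lemma mono_count_paw_edges:
  "mono_count \<phi> (paw_edges d i) =
     of_bool (\<phi> (Hub d i) = \<phi> (Selector d (3 - d ! i))) + of_bool (\<phi> (Hub d i) = \<phi> (Portal i)) +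
     of_bool (\<phi> (Selector d (3 - d ! i)) = \<phi> (Portal i)) +
     of_bool (\<phi> (Hub d i) = \<phi> (Terminal (d ! i)))"
  by (simp add: mono_count_def paw_edges_def doubleton_eq_iff)

text \<open>Every edge of the paw at \<open>i\<close> contains \<open>Hub d i\<close> or
  \<open>Portal i\<close>, and no selector edge contains a hub or a portal, so the pieces are
  disjoint.\<close>

lemma mono_count_tuple_edges:
  "mono_count \<phi> (tuple_edges r d) =
     mono_count \<phi> (selector_edges d) + (\<Sum>i<r. mono_count \<phi> (paw_edges d i))"
proof -
  have "selector_edges d \<inter> (\<Union>i<r. paw_edges d i) = {}"
    by (auto simp: selector_edges_def paw_edges_def doubleton_eq_iff)
  moreover have "\<forall>i\<in>{..<r}. \<forall>j\<in>{..<r}. i \<noteq> j \<longrightarrow> paw_edges d i \<inter> paw_edges d j = {}"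
    by (auto simp: paw_edges_def doubleton_eq_iff)
  moreover have "finite (selector_edges d)" and "finite (paw_edges d i)" for i
    by (simp_all add: selector_edges_def paw_edges_def)
  ultimately show ?thesis
    by (simp add: mono_count_def tuple_edges_def sum.union_disjoint sum.UNION_disjoint
        del: sum_of_bool_eq)
qed

text \<open>Every edge contains a selector or hub labelled by its tuple, so different tuples have
  disjoint edge sets.\<close>

lemma mono_count_relation_edges:
  assumes "finite R"
  shows "mono_count \<phi> (relation_edges r R) = (\<Sum>d\<in>R. mono_count \<phi> (tuple_edges r d))"
proof -
  have "\<forall>d\<in>R. \<forall>d'\<in>R. d \<noteq> d' \<longrightarrow> tuple_edges r d \<inter> tuple_edges r d' = {}"
    by (auto simp: tuple_edges_def selector_edges_def paw_edges_def doubleton_eq_iff)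
  then show ?thesis
    using assms finite_tuple_edges
    by (simp add: mono_count_def relation_edges_def sum.UNION_disjoint del: sum_of_bool_eq)
qed

section \<open>Lower bound and optimal coloring for one tuple\<close>

lemma mono_count_tuple_edges_ge:
  assumes d: "d \<in> color_tuples 2 r" and x: "x \<in> color_tuples 2 r"
    and terminal: "\<And>c. c \<in> {1, 2} \<Longrightarrow> \<phi> (Terminal c) = c"
    and selector: "\<And>c. c \<in> {1, 2} \<Longrightarrow> \<phi> (Selector d c) \<in> {1, 2}"
    and hub: "\<And>i. i < r \<Longrightarrow> \<phi> (Hub d i) \<in> {1, 2}"
    and portal: "\<And>i. i < r \<Longrightarrow> \<phi> (Portal i) = x ! i"
  shows "r + of_bool (x \<noteq> d) \<le> mono_count \<phi> (tuple_edges r d)"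
proof -
  \<comment> \<open>With two colors some triangle edge is monochromatic. If selector and portal both
    have color \<open>3 - d ! i\<close>, their edge is monochromatic, and the hub either agrees with
    both or agrees with the terminal.\<close>
  have paw: "1 + of_bool (x ! i \<noteq> d ! i \<and> \<phi> (Selector d (3 - d ! i)) = 3 - d ! i)
      \<le> mono_count \<phi> (paw_edges d i)" if "i < r" for i
  proof -
    have "d ! i \<in> {1, 2}" "x ! i \<in> {1, 2}"
      by (fact color_tuples_2_nth[OF d that] color_tuples_2_nth[OF x that])+
    moreover from this have "\<phi> (Terminal (d ! i)) = d ! i"
      by (intro terminal)
    moreover have "\<phi> (Selector d (3 - d ! i)) \<in> {1, 2}"
      using \<open>d ! i \<in> {1, 2}\<close> by (intro selector) auto
    ultimately show ?thesis
      unfolding mono_count_paw_edges portal[OF that] using hub[OF that]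
      by (elim insertE emptyE) simp_all
  qed
  have paw_ge_1: "1 \<le> mono_count \<phi> (paw_edges d i)" if "i < r" for i
    using le_add1 paw[OF that] by (rule le_trans)
  have base: "r \<le> (\<Sum>i<r. mono_count \<phi> (paw_edges d i))"
  proof -
    have "(\<Sum>i<r. 1) \<le> (\<Sum>i<r. mono_count \<phi> (paw_edges d i))"
      using paw_ge_1 by (intro sum_mono) simp
    then show ?thesis
      by simp
  qed
  show ?thesis
  \<comment> \<open>The paws already pay \<open>r\<close>. For \<open>x\<close> different from
    \<open>d\<close>, the extra one comes from a selector edge or, if both are properly colored,
    from a paw.\<close>
  proof (cases "x = d \<or> mono_count \<phi> (selector_edges d) > 0")
    case True
    then show ?thesis
      using base by (auto simp: mono_count_tuple_edges)
  next
    case False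
    then have on: "\<phi> (Selector d 1) = 1" "\<phi> (Selector d 2) = 2"
      using selector[of 1] selector[of 2] terminal[of 2]
      by (auto simp: mono_count_selector_edges)
    have "length x = r" "length d = r"
      using d x by (simp_all add: color_tuples_def)
    \<comment> \<open>Both selectors are on, so the paw at any position where \<open>x\<close> and
      \<open>d\<close> differ pays two.\<close>
    then obtain j where j: "j < r" "x ! j \<noteq> d ! j"
      using False by (metis nth_equalityI)
    have "d ! j \<in> {1, 2}"
      using d j(1) by (rule color_tuples_2_nth)
    then have "\<phi> (Selector d (3 - d ! j)) = 3 - d ! j"
      using on by auto
    then have "1 < mono_count \<phi> (paw_edges d j)"
      using paw[OF j(1)] j(2) by simp
    then have "(\<Sum>i<r. 1) < (\<Sum>i<r. mono_count \<phi> (paw_edges d i))"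
      using j(1) paw_ge_1 by (intro sum_strict_mono_ex1) blast+
    then show ?thesis
      using False by (simp add: mono_count_tuple_edges)
  qed
qed

text \<open>Selectors are on only for the tuple \<open>x\<close> itself, and each hub avoids the
  color of its terminal. Selectors and hubs are private to a tuple, so one coloring is optimal for
  all tuples at once.\<close>

fun optimal_coloring :: "nat list \<Rightarrow> vertex \<Rightarrow> nat" where
  "optimal_coloring x (Portal i) = x ! i"
| "optimal_coloring x (Terminal c) = c"
| "optimal_coloring x (Selector d c) = (if x = d then c else 3 - c)"
| "optimal_coloring x (Hub d i) = 3 - d ! i"

lemma mono_count_optimal_coloring:
  assumes d: "d \<in> color_tuples 2 r" and x: "x \<in> color_tuples 2 r"
  shows "mono_count (optimal_coloring x) (tuple_edges r d) = r + of_bool (x \<noteq> d)"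
proof -
  \<comment> \<open>If \<open>x = d\<close>, only the edge from hub to selector is monochromatic.
    Otherwise hub and selector differ, and the portal agrees with exactly one of them.\<close>
  have "mono_count (optimal_coloring x) (paw_edges d i) = 1" if "i < r" for i
  proof -
    have "d ! i \<in> {1, 2}" "x ! i \<in> {1, 2}"
      by (fact color_tuples_2_nth[OF d that] color_tuples_2_nth[OF x that])+
    then show ?thesis
      by (auto simp: mono_count_paw_edges)
  qed
  then show ?thesis
    by (simp add: mono_count_tuple_edges mono_count_selector_edges)
qed

section \<open>The gadget for a relation and its cost\<close>

definition relation_gadget :: "nat \<Rightarrow> nat list set \<Rightarrow> nat gadget" where
  "relation_gadget r R =
     \<lparr>graph = \<lparr>verts = to_nat ` vertex_set r R, edges = (`) to_nat ` relation_edges r R\<rparr>,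
      color_list = vertex_list \<circ> from_nat,
      portals = map (to_nat \<circ> Portal) [0..<r]\<rparr>"

text \<open>Entries of \<open>d\<close> lie in {1, 2}, hence so do \<open>d ! i\<close> and
  \<open>3 - d ! i\<close>, and the terminals and selectors they index are vertices.\<close>

lemma relation_edges_subset:
  assumes "R \<subseteq> color_tuples 2 r" and "e \<in> relation_edges r R"
  shows "e \<subseteq> vertex_set r R \<and> card e = 2"
proof -
  obtain d where d: "d \<in> R" "e \<in> tuple_edges r d"
    using assms(2) by (auto simp: relation_edges_def)
  then consider "e \<in> selector_edges d" | i where "i < r" "e \<in> paw_edges d i"
    by (auto simp: tuple_edges_def)
  then show ?thesis
  proof cases
    case 1
    then show ?thesis
      using d(1) by (auto simp: selector_edges_def vertex_set_def)
  next
    case 2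
    then have "d ! i \<in> {1, 2}"
      using assms(1) d(1) color_tuples_2_nth by blast
    then show ?thesis
      using 2 d(1) by (auto simp: paw_edges_def vertex_set_def)
  qed
qed

lemma is_gadget_relation_gadget:
  assumes "R \<subseteq> color_tuples 2 r"
  shows "is_gadget 2 r (relation_gadget r R)"
proof -
  have "finite R"
    using assms finite_color_tuples by (rule finite_subset)
  then have "finite (vertex_set r R)"
    by (simp add: vertex_set_def)
  moreover have "card (to_nat ` e) = card e" for e :: "vertex set"
    by (simp add: card_image)
  moreover have "vertex_list v \<subseteq> {1..2}" if "v \<in> vertex_set r R" for v
    using that by (auto simp: vertex_set_def)
  moreover have "distinct (map (to_nat \<circ> Portal) [0..<r])"
    by (simp add: distinct_map inj_on_def)
  moreover have "Portal i \<in> vertex_set r R" if "i < r" for i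
    using that by (simp add: vertex_set_def)
  ultimately show ?thesis
    using relation_edges_subset[OF assms]
    by (auto simp: is_gadget_def simple_graph_def relation_gadget_def image_mono)
qed

lemma cost_ed_relation_gadget:
  assumes R: "R \<subseteq> color_tuples 2 r" and x: "x \<in> color_tuples 2 r"
  shows "cost_ed 2 (relation_gadget r R) x = ereal (real (\<Sum>d\<in>R. r + of_bool (x \<noteq> d)))"
proof (rule cost_ed_eqI)
  let ?J = "relation_gadget r R"
  let ?opt = "optimal_coloring x \<circ> from_nat"
  have "finite R"
    using R finite_color_tuples by (rule finite_subset)
  then have count: "mono_count \<phi> (edges (graph ?J)) = (\<Sum>d\<in>R. mono_count (\<phi> \<circ> to_nat) (tuple_edges r d))"
    for \<phi>
    by (simp add: relation_gadget_def mono_count_image mono_count_relation_edges)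
  have [simp]: "length x = r"
    using x by (simp add: color_tuples_def)
  show "simple_graph (graph ?J)"
    using is_gadget_relation_gadget[OF R] by (simp add: is_gadget_def)
  have "optimal_coloring x v \<in> vertex_list v \<and> optimal_coloring x v \<in> {1..2}"
    if "v \<in> vertex_set r R" for v
  proof -
    have "y ! i = 1 \<or> y ! i = 2" if "y \<in> color_tuples 2 r" "i < r" for y i
      using color_tuples_2_nth[OF that] by blast
    then show ?thesis
      using that R x by (fastforce simp: vertex_set_def)
  qed
  moreover have "map (?opt \<circ> (to_nat \<circ> Portal)) [0..<r] = x"
    by (simp add: list_eq_iff_nth_eq)
  ultimately show "portal_coloring 2 ?J x ?opt"
    by (auto simp: portal_coloring_def relation_gadget_def)
  have "?opt \<circ> to_nat = optimal_coloring x"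
    by auto
  then have "mono_count ?opt (edges (graph ?J)) = (\<Sum>d\<in>R. r + of_bool (x \<noteq> d))"
    using R x by (auto simp: count mono_count_optimal_coloring intro!: sum.cong)
  then show "mono_count ?opt (edges (graph ?J)) \<le> (\<Sum>d\<in>R. r + of_bool (x \<noteq> d))"
    by simp
  fix \<psi> assume \<psi>: "portal_coloring 2 ?J x \<psi>"
  then have lists: "(\<psi> \<circ> to_nat) v \<in> vertex_list v" if "v \<in> vertex_set r R" for v
    using that by (auto simp: portal_coloring_def relation_gadget_def)
  have map: "map (\<psi> \<circ> (to_nat \<circ> Portal)) [0..<r] = x"
    using \<psi> by (simp add: portal_coloring_def relation_gadget_def)
  have portal: "(\<psi> \<circ> to_nat) (Portal i) = x ! i" if "i < r" for i
    using that by (simp flip: map)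
  show "(\<Sum>d\<in>R. r + of_bool (x \<noteq> d)) \<le> mono_count \<psi> (edges (graph ?J))"
    unfolding count
  proof (rule sum_mono)
    fix d assume d: "d \<in> R"
    show "r + of_bool (x \<noteq> d) \<le> mono_count (\<psi> \<circ> to_nat) (tuple_edges r d)"
    proof (rule mono_count_tuple_edges_ge)
      show "d \<in> color_tuples 2 r"
        using d R by blast
      show "(\<psi> \<circ> to_nat) (Terminal c) = c" if "c \<in> {1, 2}" for c
        using lists[of "Terminal c"] that by (auto simp: vertex_set_def)
      show "(\<psi> \<circ> to_nat) (Selector d c) \<in> {1, 2}" if "c \<in> {1, 2}" for c
        using lists[of "Selector d c"] that d by (auto simp: vertex_set_def)
      show "(\<psi> \<circ> to_nat) (Hub d i) \<in> {1, 2}" if "i < r" for i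
        using lists[of "Hub d i"] that d by (auto simp: vertex_set_def)
    qed (use x portal in auto)
  qed
qed

theorem theorem2p3:
  fixes r :: nat and R :: "nat list set"
  assumes "r \<ge> 1" and "R \<subseteq> color_tuples 2 r"
  shows "\<exists>J :: nat gadget. is_gadget 2 r J \<and> omega_realizes 2 r 1 J R"
proof (intro exI conjI)
  let ?J = "relation_gadget r R"
  \<comment> \<open>A tuple outside \<open>R\<close> pays \<open>r + 1\<close> for each member of
    \<open>R\<close>; a tuple in \<open>R\<close> saves one. The subtraction is over the integers:
    for empty \<open>R\<close> the value is -1 and every tuple costs 0.\<close>
  let ?k = "int (card R * (r + 1)) - 1"
  show "is_gadget 2 r ?J"
    using assms(2) by (rule is_gadget_relation_gadget)
  have fin: "finite R"
    using assms(2) finite_color_tuples by (rule finite_subset)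
  have on: "cost_ed 2 ?J x = ereal (of_int ?k)" if "x \<in> R" for x
  proof -
    \<comment> \<open>The saving is in the summand \<open>d = x\<close>, which is split off.\<close>
    have "(\<Sum>d\<in>R. r + of_bool (x \<noteq> d)) = (r + 0) + (\<Sum>d\<in>R - {x}. r + 1)"
      unfolding sum.remove[OF fin that]
    proof (rule arg_cong2[where f = "(+)"])
      show "(\<Sum>d\<in>R - {x}. r + of_bool (x \<noteq> d)) = (\<Sum>d\<in>R - {x}. r + 1)"
      proof (rule sum.cong)
        fix d assume "d \<in> R - {x}"
        then have "x \<noteq> d"
          by blast
        then show "r + of_bool (x \<noteq> d) = r + 1"
          by simp
      qed simp
    qed simp
    also have "\<dots> + 1 = card R * (r + 1)"
      using card.remove[OF fin that] by simp
    finally have "int (\<Sum>d\<in>R. r + of_bool (x \<noteq> d)) = ?k"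
      by linarith
    then have "real (\<Sum>d\<in>R. r + of_bool (x \<noteq> d)) = of_int ?k"
      by (metis of_int_of_nat_eq)
    then show ?thesis
      using cost_ed_relation_gadget[OF assms(2), of x] that assms(2) by auto
  qed
  have off: "cost_ed 2 ?J x = ereal (of_int (?k + 1))" if "x \<in> color_tuples 2 r - R" for x
  proof -
    have "(\<Sum>d\<in>R. r + of_bool (x \<noteq> d)) = (\<Sum>d\<in>R. r + 1)"
      using that by (intro sum.cong) auto
    then show ?thesis
      using cost_ed_relation_gadget[OF assms(2), of x] that by simp
  qed
  show "omega_realizes 2 r 1 ?J R"
    unfolding omega_realizes_def realizes_with_def
    using on off by (intro exI[of _ ?k]) simp
qed

end
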